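(* The parametric complexity of a histogram model is a function of the sample size $n$ and the number of bins (regions) $K$ only; given $n$ and $K$, it is independent of the dimensionality of the data. Precisely: there is a function $C:\mathbb{Z}_{\ge 1}\times\mathbb{Z}_{\ge 1}\to\mathbb{R}$ such that for every dimension $l\ge 1$, every precision $\epsilon>0$, every sample space $S\subset\mathbb{R}^l$ that is a bounded box covered by a fixed grid of granularity $\epsilon$, every partition $\widetilde{S}=\{S_1,\dots,S_K\}$ of $S$ into $K\ge 1$ regions, each region being a nonempty union of grid cells, and every $n\ge 1$, $$\mathrm{COMP}(n,\widetilde{S}) = C(n,K).$$
   Context: Setting. Data are recorded up to a precision $\epsilon>0$. The sample space $S\subset\mathbb{R}^l$ is a bounded box divided into finitely many grid cells, each a cube of side $\epsilon$ (volume $\epsilon^l$). A data point can take one of finitely many possible positions in $S$, one position per grid cell; so a region $S_j$ that is a union of grid cells contains exactly $|S_j|/\epsilon^l$ possible positions, where $|S_j|$ denotes the $l$-dimensional volume of $S_j$. In sums over $y^n\in S^n$, $y^n=(y_1,\dots,y_n)$ ranges over all ordered sequences of $n$ possible positions in $S$ (repetitions allowed). Histogram model. A histogram model is a partition $\widetilde{S}=\{S_1,\dots,S_K\}$ of $S$ into $K$ pairwise disjoint regions with union $S$. For a parameter vector $\vec f=(f_1,\dots,f_K)$ with $f_j\ge 0$ and $\sum_{j=1}^K f_j|S_j|=1$, the distribution $\widetilde{S}_{\vec f}$ has constant density $f_j$ on $S_j$; a single data point located in $S_j$ has probability $f_j\epsilon^l$ (the mass of its cell), and data points are independent. Maximum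 likelihood. For $y^n\in S^n$ let $h_j(y^n)$ be the number of indices $i$ with $y_i\in S_j$. The maximum likelihood estimator $\hat{\vec f}(y^n)$ is $\hat f_j = \dfrac{h_j(y^n)}{n\,|S_j|}$, so $$P\bigl(y^n\mid \widetilde{S}_{\hat{\vec f}(y^n)}\bigr)=\prod_{j=1}^K\left(\frac{h_j(y^n)\,\epsilon^l}{n\,|S_j|}\right)^{h_j(y^n)},$$ with the convention $0^0=1$. Parametric complexity. $\displaystyle \mathrm{COMP}(n,\widetilde{S})=\sum_{y^n\in S^n}P\bigl(y^n\mid \widetilde{S}_{\hat{\vec f}(y^n)}\bigr).$ *)

theory Defs
  imports "HOL-Analysis.Analysis" "HOL-Library.Disjoint_Sets"
begin

text \<open>
  The dimension \<open>l\<close> must be quantified inside formulas, so a point of \<open>l\<close>-dimensional space is a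
  function in \<open>{..<l} \<rightarrow>\<^sub>E UNIV\<close>, and volume is Lebesgue-Borel measure on the \<open>l\<close>-fold product.
\<close>

type_synonym point = "nat \<Rightarrow> real"

definition region_volume :: "nat \<Rightarrow> point set \<Rightarrow> real" where
  "region_volume l A = measure (Pi\<^sub>M {..<l} (\<lambda>_. lborel)) A"

text \<open>
  The box with lower corner \<open>a\<close> that has \<open>m i\<close> grid cells of side \<open>\<epsilon>\<close> in direction \<open>i\<close>.
  Boxes and cells are half-open, so that distinct cells are disjoint.
\<close>

definition sample_box :: "nat \<Rightarrow> real \<Rightarrow> point \<Rightarrow> (nat \<Rightarrow> nat) \<Rightarrow> point set" where
  "sample_box l \<epsilon> a m = (\<Pi>\<^sub>E i\<in>{..<l}. {a i ..< a i + real (m i) * \<epsilon>})"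

definition grid_cell :: "nat \<Rightarrow> real \<Rightarrow> point \<Rightarrow> (nat \<Rightarrow> nat) \<Rightarrow> point set" where
  "grid_cell l \<epsilon> a k =
     (\<Pi>\<^sub>E i\<in>{..<l}. {a i + real (k i) * \<epsilon> ..< a i + real (k i + 1) * \<epsilon>})"

definition grid_cells :: "nat \<Rightarrow> real \<Rightarrow> point \<Rightarrow> (nat \<Rightarrow> nat) \<Rightarrow> point set set" where
  "grid_cells l \<epsilon> a m = grid_cell l \<epsilon> a ` (\<Pi>\<^sub>E i\<in>{..<l}. {..<m i})"

text \<open>\<open>X\<close> is a set of possible data positions: one, chosen arbitrarily, in each cell.\<close>

definition possible_positions ::
    "nat \<Rightarrow> real \<Rightarrow> point \<Rightarrow> (nat \<Rightarrow> nat) \<Rightarrow> point set \<Rightarrow> bool" where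
  "possible_positions l \<epsilon> a m X \<longleftrightarrow>
     X \<subseteq> sample_box l \<epsilon> a m \<and> (\<forall>c\<in>grid_cells l \<epsilon> a m. \<exists>!x. x \<in> X \<and> x \<in> c)"

text \<open>
  A histogram model is the set \<open>P\<close> of its regions (nonempty by \<open>partition_on\<close>), and
  the number of bins is \<open>card P\<close>. Parameter vectors are indexed by the regions themselves.
\<close>

definition histogram_model ::
    "nat \<Rightarrow> real \<Rightarrow> point \<Rightarrow> (nat \<Rightarrow> nat) \<Rightarrow> point set set \<Rightarrow> bool" where
  "histogram_model l \<epsilon> a m P \<longleftrightarrow>
     partition_on (sample_box l \<epsilon> a m) P \<and>
     (\<forall>A\<in>P. \<exists>D\<subseteq>grid_cells l \<epsilon> a m. A = \<Union>D)"

definition histogram_params :: "nat \<Rightarrow> point set set \<Rightarrow> (point set \<Rightarrow> real) set" where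
  "histogram_params l P = {f. (\<forall>A\<in>P. 0 \<le> f A) \<and> (\<Sum>A\<in>P. f A * region_volume l A) = 1}"

definition histogram_density :: "point set set \<Rightarrow> (point set \<Rightarrow> real) \<Rightarrow> point \<Rightarrow> real" where
  "histogram_density P f x = (\<Sum>A\<in>P. f A * indicator A x)"

text \<open>A sample of size \<open>n\<close> is a function on \<open>{..<n}\<close>.\<close>

definition likelihood ::
    "nat \<Rightarrow> real \<Rightarrow> point set set \<Rightarrow> (point set \<Rightarrow> real) \<Rightarrow> nat \<Rightarrow> (nat \<Rightarrow> point) \<Rightarrow> real" where
  "likelihood l \<epsilon> P f n y = (\<Prod>i<n. histogram_density P f (y i) * \<epsilon> ^ l)"

definition bin_count :: "nat \<Rightarrow> (nat \<Rightarrow> point) \<Rightarrow> point set \<Rightarrow> nat" where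
  "bin_count n y A = card {i. i < n \<and> y i \<in> A}"

definition ml_estimator :: "nat \<Rightarrow> nat \<Rightarrow> (nat \<Rightarrow> point) \<Rightarrow> point set \<Rightarrow> real" where
  "ml_estimator l n y A = real (bin_count n y A) / (real n * region_volume l A)"

definition COMP :: "nat \<Rightarrow> real \<Rightarrow> point set \<Rightarrow> nat \<Rightarrow> point set set \<Rightarrow> real" where
  "COMP l \<epsilon> X n P =
     (\<Sum>y\<in>{..<n} \<rightarrow>\<^sub>E X. likelihood l \<epsilon> P (ml_estimator l n y) n y)"

lemma histogram_density_eq:
  assumes "finite P" "partition_on S P" "A \<in> P" "x \<in> A"
  shows "histogram_density P f x = f A"
proof -
  have "f B * indicator B x = (if B = A then f B else 0)" if "B \<in> P" for B
  proof (cases "B = A")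
    case True
    with \<open>x \<in> A\<close> show ?thesis by simp
  next
    case False
    then have "B \<inter> A = {}"
      using assms(2,3) that by (auto simp: partition_on_def dest: disjointD)
    with \<open>x \<in> A\<close> have "x \<notin> B" by blast
    with False show ?thesis by simp
  qed
  then have "histogram_density P f x = (\<Sum>B\<in>P. if B = A then f B else 0)"
    unfolding histogram_density_def by (rule sum.cong[OF refl])
  with assms(1,3) show ?thesis by simp
qed

lemma sample_index_partition:
  assumes "partition_on S P" "y \<in> {..<n} \<rightarrow> S"
  shows "{..<n} = (\<Union>A\<in>P. {i. i < n \<and> y i \<in> A})"
    and "\<forall>A\<in>P. \<forall>B\<in>P. A \<noteq> B \<longrightarrow> {i. i < n \<and> y i \<in> A} \<inter> {i. i < n \<and> y i \<in> B} = {}"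
proof -
  have "y i \<in> \<Union>P" if "i < n" for i
    using assms that by (auto simp: partition_on_def)
  then show "{..<n} = (\<Union>A\<in>P. {i. i < n \<and> y i \<in> A})"
    by auto
  have "A \<inter> B = {}" if "A \<in> P" "B \<in> P" "A \<noteq> B" for A B
    using assms(1) that by (auto simp: partition_on_def dest: disjointD)
  then show "\<forall>A\<in>P. \<forall>B\<in>P. A \<noteq> B \<longrightarrow> {i. i < n \<and> y i \<in> A} \<inter> {i. i < n \<and> y i \<in> B} = {}"
    by blast
qed

text \<open>The usual closed form of the maximum likelihood; note that \<open>0 ^ 0 = 1\<close>.\<close>

lemma likelihood_ml_estimator:
  assumes "finite P" "partition_on S P" "y \<in> {..<n} \<rightarrow> S"
  shows "likelihood l \<epsilon> P (ml_estimator l n y) n y =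
    (\<Prod>A\<in>P. (real (bin_count n y A) * \<epsilon> ^ l / (real n * region_volume l A)) ^ bin_count n y A)"
proof -
  let ?f = "ml_estimator l n y" and ?I = "\<lambda>A. {i. i < n \<and> y i \<in> A}"
  have "likelihood l \<epsilon> P ?f n y =
      (\<Prod>i\<in>(\<Union>A\<in>P. ?I A). histogram_density P ?f (y i) * \<epsilon> ^ l)"
    unfolding likelihood_def sample_index_partition(1)[OF assms(2,3), symmetric] ..
  also have "\<dots> = (\<Prod>A\<in>P. \<Prod>i\<in>?I A. histogram_density P ?f (y i) * \<epsilon> ^ l)"
    using assms(1) sample_index_partition(2)[OF assms(2,3)]
    by (intro prod.UNION_disjoint) auto
  also have "\<dots> = (\<Prod>A\<in>P. \<Prod>i\<in>?I A. ?f A * \<epsilon> ^ l)"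
    using histogram_density_eq[OF assms(1,2)] by (intro prod.cong) auto
  also have "\<dots> = (\<Prod>A\<in>P. (?f A * \<epsilon> ^ l) ^ bin_count n y A)"
    by (simp add: bin_count_def)
  finally show ?thesis by (simp add: ml_estimator_def)
qed

lemma ml_estimator_in_params:
  assumes "finite P" "partition_on S P" "y \<in> {..<n} \<rightarrow> S" "n \<ge> 1" "\<forall>A\<in>P. region_volume l A > 0"
  shows "ml_estimator l n y \<in> histogram_params l P"
proof -
  have "card {..<n} = card (\<Union>A\<in>P. {i. i < n \<and> y i \<in> A})"
    by (rule arg_cong[OF sample_index_partition(1)[OF assms(2,3)]])
  also have "\<dots> = (\<Sum>A\<in>P. bin_count n y A)"
    unfolding bin_count_def
    using assms(1) sample_index_partition(2)[OF assms(2,3)]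
    by (intro card_UN_disjoint) auto
  finally have "(\<Sum>A\<in>P. bin_count n y A) = n"
    by (simp only: card_lessThan)
  from arg_cong[OF this, of real] have n: "(\<Sum>A\<in>P. real (bin_count n y A)) = real n"
    by (simp only: of_nat_sum)
  have "(\<Sum>A\<in>P. ml_estimator l n y A * region_volume l A) =
      (\<Sum>A\<in>P. real (bin_count n y A) / real n)"
    using assms(5) by (intro sum.cong) (auto simp: ml_estimator_def)
  also have "\<dots> = (\<Sum>A\<in>P. real (bin_count n y A)) / real n"
    by (simp add: sum_divide_distrib)
  also have "\<dots> = 1"
    using assms(4) by (simp add: n)
  finally show ?thesis
    using assms(5) by (auto simp: histogram_params_def ml_estimator_def less_imp_le)
qed

end

theory Submission
  imports Defs
begin

text \<open>
  Sort the samples \<open>y\<close> by the sequence \<open>z\<close> of regions that they visit. If a region \<open>A\<close> has \<open>N A\<close>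
  cells, there are \<open>\<Prod>A. N A ^ c A\<close> samples with sequence \<open>z\<close>, where \<open>c A\<close> is the number of
  visits to \<open>A\<close>, and each has maximum likelihood \<open>\<Prod>A. (c A / (n * N A)) ^ c A\<close>.
  The factors \<open>N A\<close> cancel, and what remains is a sum over words of length \<open>n\<close> in \<open>K\<close> letters.
\<close>

definition label_count :: "nat \<Rightarrow> (nat \<Rightarrow> 'b) \<Rightarrow> 'b \<Rightarrow> nat" where
  "label_count n z j = card {i. i < n \<and> z i = j}"

text \<open>The normalizing sum of the multinomial maximum likelihood, left as a sum over words
  instead of being grouped by count vectors. The letter type is arbitrary, so that \<open>J\<close>
  can be the set of regions itself as well as \<open>{..<K}\<close>.\<close>

definition multinomial_complexity :: "nat \<Rightarrow> 'b set \<Rightarrow> real" where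
  "multinomial_complexity n J =
     (\<Sum>z\<in>{..<n} \<rightarrow>\<^sub>E J. \<Prod>j\<in>J. (real (label_count n z j) / real n) ^ label_count n z j)"

text \<open>Renaming the letters permutes neither positions nor counts: injectivity of
  \<open>f\<close> keeps distinct letters apart. Hence only the number of letters matters, which is
  how the regions are finally forgotten.\<close>

lemma multinomial_complexity_bij:
  assumes f: "bij_betw f I J"
  shows "multinomial_complexity n I = multinomial_complexity n J"
proof -
  \<comment> \<open>Words are extensional functions, so both renamings are restricted to
    \<open>{..<n}\<close> to yield words again.\<close>
  let ?g = "\<lambda>z. \<lambda>i\<in>{..<n}. f (z i)" and ?h = "\<lambda>z. \<lambda>i\<in>{..<n}. inv_into I f (z i)"
  have count: "label_count n (?g z) (f j) = label_count n z j"
    if "z \<in> {..<n} \<rightarrow>\<^sub>E I" "j \<in> I" for z j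
  proof -
    have "f (z i) = f j \<longleftrightarrow> z i = j" if "i < n" for i
      using f \<open>z \<in> _\<close> \<open>j \<in> I\<close> that
      by (intro inj_on_eq_iff[of f I]) (auto simp: bij_betw_def PiE_iff)
    then show ?thesis
      by (auto simp: label_count_def intro!: arg_cong[of _ _ card])
  qed
  have "bij_betw ?g ({..<n} \<rightarrow>\<^sub>E I) ({..<n} \<rightarrow>\<^sub>E J)"
  proof (rule bij_betw_byWitness[where f' = ?h])
    show "\<forall>z\<in>{..<n} \<rightarrow>\<^sub>E I. ?h (?g z) = z"
      using f by (auto simp: bij_betw_def fun_eq_iff PiE_iff extensional_def)
    show "\<forall>z\<in>{..<n} \<rightarrow>\<^sub>E J. ?g (?h z) = z"
      using f by (auto simp: bij_betw_def fun_eq_iff PiE_iff extensional_def f_inv_into_f)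
    show "?g ` ({..<n} \<rightarrow>\<^sub>E I) \<subseteq> {..<n} \<rightarrow>\<^sub>E J"
      using f by (auto simp: bij_betw_def)
    show "?h ` ({..<n} \<rightarrow>\<^sub>E J) \<subseteq> {..<n} \<rightarrow>\<^sub>E I"
      using bij_betw_apply[OF bij_betw_inv_into[OF f]]
      by (intro image_subsetI restrict_PiE_iff[THEN iffD2] ballI) (simp add: PiE_iff)
  qed
  then have "multinomial_complexity n J = (\<Sum>z\<in>{..<n} \<rightarrow>\<^sub>E I.
      \<Prod>j\<in>J. (real (label_count n (?g z) j) / real n) ^ label_count n (?g z) j)"
    unfolding multinomial_complexity_def by (rule sum.reindex_bij_betw[symmetric])
  also have "\<dots> = (\<Sum>z\<in>{..<n} \<rightarrow>\<^sub>E I.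
      \<Prod>j\<in>I. (real (label_count n (?g z) (f j)) / real n) ^ label_count n (?g z) (f j))"
    by (intro sum.cong refl prod.reindex_bij_betw[OF f, symmetric])
  also have "\<dots> = multinomial_complexity n I"
    unfolding multinomial_complexity_def by (simp add: count)
  finally show ?thesis ..
qed

text \<open>Positions are grouped by their letter. With \<open>w A\<close> the number of data
  positions in \<open>A\<close>, this turns the size of a fibre into a product of powers over the
  regions.\<close>

lemma prod_label_count:
  fixes w :: "'b \<Rightarrow> 'c::comm_monoid_mult"
  assumes "finite J" "z \<in> {..<n} \<rightarrow> J"
  shows "(\<Prod>i<n. w (z i)) = (\<Prod>j\<in>J. w j ^ label_count n z j)"
proof -
  have "(\<Prod>i<n. w (z i)) = (\<Prod>j\<in>J. \<Prod>i | i \<in> {..<n} \<and> z i = j. w (z i))"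
    using assms by (intro prod.group[symmetric]) auto
  also have "\<dots> = (\<Prod>j\<in>J. w j ^ label_count n z j)"
    by (intro prod.cong) (auto simp: label_count_def)
  finally show ?thesis .
qed

text \<open>The sets on the right are the fibres of the map from a sample to its sequence of
  regions. They are disjoint because two different sequences differ at some index, where the two
  regions have no common point.\<close>

lemma PiE_partition:
  assumes P: "partition_on S P" and "X \<subseteq> S"
  shows "I \<rightarrow>\<^sub>E X = (\<Union>z\<in>I \<rightarrow>\<^sub>E P. \<Pi>\<^sub>E i\<in>I. X \<inter> z i)"
    and "\<lbrakk>z \<in> I \<rightarrow>\<^sub>E P; z' \<in> I \<rightarrow>\<^sub>E P; z \<noteq> z'\<rbrakk>
      \<Longrightarrow> (\<Pi>\<^sub>E i\<in>I. X \<inter> z i) \<inter> (\<Pi>\<^sub>E i\<in>I. X \<inter> z' i) = {}"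
proof -
  show "I \<rightarrow>\<^sub>E X = (\<Union>z\<in>I \<rightarrow>\<^sub>E P. \<Pi>\<^sub>E i\<in>I. X \<inter> z i)"
  proof (intro equalityI subsetI)
    fix y assume y: "y \<in> I \<rightarrow>\<^sub>E X"
    have "\<exists>A. A \<in> P \<and> y i \<in> A" if "i \<in> I" for i
      using that y assms by (auto simp: partition_on_def PiE_iff)
    then obtain z where z: "\<And>i. i \<in> I \<Longrightarrow> z i \<in> P \<and> y i \<in> z i" by metis
    with y show "y \<in> (\<Union>z\<in>I \<rightarrow>\<^sub>E P. \<Pi>\<^sub>E i\<in>I. X \<inter> z i)"
      \<comment> \<open>The chosen \<open>z\<close> is arbitrary outside \<open>I\<close>, hence the
        restriction.\<close>
      by (intro UN_I[of "restrict z I"]) (auto simp: PiE_iff)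
  qed (auto simp: PiE_iff)
  assume z: "z \<in> I \<rightarrow>\<^sub>E P" "z' \<in> I \<rightarrow>\<^sub>E P" "z \<noteq> z'"
  then obtain i where i: "i \<in> I" "z i \<noteq> z' i" by (meson PiE_ext)
  with z P have "z i \<inter> z' i = {}"
    by (auto simp: partition_on_def PiE_iff dest: disjointD)
  with i show "(\<Pi>\<^sub>E i\<in>I. X \<inter> z i) \<inter> (\<Pi>\<^sub>E i\<in>I. X \<inter> z' i) = {}"
    by (force simp: PiE_iff)
qed

text \<open>Regions are disjoint, so \<open>y i\<close> lies in \<open>A\<close> only if its region
  \<open>z i\<close> is \<open>A\<close>. This makes the maximum likelihood constant on each
  fibre.\<close>

lemma bin_count_eq_label_count:
  assumes P: "partition_on S P" and z: "z \<in> {..<n} \<rightarrow>\<^sub>E P" and A: "A \<in> P"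
    and y: "y \<in> (\<Pi>\<^sub>E i\<in>{..<n}. X \<inter> z i)"
  shows "bin_count n y A = label_count n z A"
proof -
  have "y i \<in> A \<longleftrightarrow> z i = A" if "i < n" for i
  proof -
    have "y i \<in> z i" "z i \<in> P"
      using y z that by (auto simp: PiE_iff)
    then show ?thesis
      using P A disjointD[of P "z i" A] by (auto simp: partition_on_def)
  qed
  then show ?thesis
    unfolding bin_count_def label_count_def by (intro arg_cong[of _ _ card]) auto
qed

lemma sum_max_likelihood:
  assumes fin: "finite P" "finite X" and P: "partition_on S P" and X: "X \<subseteq> S"
    and ne: "\<And>A. A \<in> P \<Longrightarrow> X \<inter> A \<noteq> {}"
  shows "(\<Sum>y\<in>{..<n} \<rightarrow>\<^sub>E X. \<Prod>A\<in>P.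
      (real (bin_count n y A) / (real n * real (card (X \<inter> A)))) ^ bin_count n y A) =
    multinomial_complexity n P" (is "(\<Sum>y\<in>_. ?L y) = _")
proof -
  let ?Y = "\<lambda>z. \<Pi>\<^sub>E i\<in>{..<n}. X \<inter> z i"
  let ?c = "\<lambda>z A. label_count n z A"
  have "(\<Sum>y\<in>{..<n} \<rightarrow>\<^sub>E X. ?L y) = (\<Sum>z\<in>{..<n} \<rightarrow>\<^sub>E P. \<Sum>y\<in>?Y z. ?L y)"
    unfolding PiE_partition(1)[OF P X]
    using fin PiE_partition(2)[OF P X]
    by (intro sum.UNION_disjoint) (auto intro!: finite_PiE)
  also have "\<dots> = multinomial_complexity n P"
    unfolding multinomial_complexity_def
  proof (rule sum.cong[OF refl])
    fix z assume z: "z \<in> {..<n} \<rightarrow>\<^sub>E P"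
    have "(\<Sum>y\<in>?Y z. ?L y) = (\<Sum>y\<in>?Y z. \<Prod>A\<in>P.
        (real (?c z A) / (real n * real (card (X \<inter> A)))) ^ ?c z A)"
      by (intro sum.cong prod.cong refl) (simp add: bin_count_eq_label_count[OF P z])
    \<comment> \<open>The summand no longer depends on \<open>y\<close>, so the sum is the size of
      the fibre times its value.\<close>
    also have "\<dots> = real (\<Prod>i<n. card (X \<inter> z i)) * (\<Prod>A\<in>P.
        (real (?c z A) / (real n * real (card (X \<inter> A)))) ^ ?c z A)"
      by (simp add: card_PiE)
    also have "(\<Prod>i<n. card (X \<inter> z i)) = (\<Prod>A\<in>P. card (X \<inter> A) ^ ?c z A)"
      using z fin by (intro prod_label_count[of P z n "\<lambda>A. card (X \<inter> A)"]) auto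
    also have "real \<dots> * (\<Prod>A\<in>P. (real (?c z A) / (real n * real (card (X \<inter> A)))) ^ ?c z A) =
        (\<Prod>A\<in>P. (real (?c z A) / real n) ^ ?c z A)"
      \<comment> \<open>The cancellation takes place region by region and divides by
        \<open>card (X \<inter> A)\<close>, which is nonzero by \<open>ne\<close>.\<close>
      using ne fin
      by (simp flip: prod.distrib power_mult_distrib)
    finally show "(\<Sum>y\<in>?Y z. ?L y) = (\<Prod>A\<in>P. (real (?c z A) / real n) ^ ?c z A)" .
  qed
  finally show ?thesis .
qed

lemma disjoint_grid_cells:
  assumes "\<epsilon> > 0"
  shows "disjoint (grid_cells l \<epsilon> a m)"
proof (rule disjointI)
  fix c d assume "c \<in> grid_cells l \<epsilon> a m" "d \<in> grid_cells l \<epsilon> a m" and neq: "c \<noteq> d"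
  then obtain k k' where c: "c = grid_cell l \<epsilon> a k" and d: "d = grid_cell l \<epsilon> a k'"
    by (auto simp: grid_cells_def)
  show "c \<inter> d = {}"
  proof (rule ccontr)
    assume "c \<inter> d \<noteq> {}"
    then obtain x where x: "x \<in> c" "x \<in> d" by blast
    have "k i = k' i" if "i < l" for i
    proof -
      have "a i + real (k i) * \<epsilon> < a i + real (k' i + 1) * \<epsilon>"
        "a i + real (k' i) * \<epsilon> < a i + real (k i + 1) * \<epsilon>"
        using x that unfolding c d grid_cell_def PiE_iff
        by (meson atLeastLessThan_iff lessThan_iff le_less_trans)+
      \<comment> \<open>A common point bounds each index strictly by the successor of the other; for
        natural numbers this forces equality. Strictness comes from the half-open intervals.\<close>
      with assms have "real (k i) < real (k' i + 1)" "real (k' i) < real (k i + 1)"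
        by simp_all
      then show ?thesis by linarith
    qed
    then have "c = d"
      unfolding c d grid_cell_def by (intro PiE_cong) simp
    with neq show False ..
  qed
qed

lemma emeasure_grid_cell:
  assumes "\<epsilon> > 0"
  shows "grid_cell l \<epsilon> a k \<in> sets (Pi\<^sub>M {..<l} (\<lambda>_. lborel))"
    and "emeasure (Pi\<^sub>M {..<l} (\<lambda>_. lborel)) (grid_cell l \<epsilon> a k) = ennreal (\<epsilon> ^ l)"
proof -
  interpret product_sigma_finite "\<lambda>_::nat. lborel :: real measure" ..
  show "grid_cell l \<epsilon> a k \<in> sets (Pi\<^sub>M {..<l} (\<lambda>_. lborel))"
    unfolding grid_cell_def by (intro sets_PiM_I_finite) auto
  have "emeasure (Pi\<^sub>M {..<l} (\<lambda>_. lborel)) (grid_cell l \<epsilon> a k) = (\<Prod>i<l. ennreal \<epsilon>)"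
    unfolding grid_cell_def using assms
    by (subst emeasure_PiM) (auto intro!: prod.cong simp: algebra_simps)
  also have "\<dots> = ennreal (\<epsilon> ^ l)"
    using assms by (simp add: ennreal_power)
  finally show "emeasure (Pi\<^sub>M {..<l} (\<lambda>_. lborel)) (grid_cell l \<epsilon> a k) = ennreal (\<epsilon> ^ l)" .
qed

lemma finite_grid_cells: "finite (grid_cells l \<epsilon> a m)"
  unfolding grid_cells_def by (intro finite_imageI finite_PiE) auto

text \<open>Finite additivity over disjoint cells of equal volume. Together with the next lemma it
  identifies \<open>region_volume l A / \<epsilon> ^ l\<close> with the number of data positions in
  a region \<open>A\<close>.\<close>

lemma region_volume_Union_cells:
  assumes "\<epsilon> > 0" and D: "D \<subseteq> grid_cells l \<epsilon> a m"
  shows "region_volume l (\<Union>D) = real (card D) * \<epsilon> ^ l"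
proof -
  let ?M = "Pi\<^sub>M {..<l} (\<lambda>_. lborel :: real measure)"
  have cell: "c \<in> sets ?M" "emeasure ?M c = ennreal (\<epsilon> ^ l)" if "c \<in> D" for c
    using that D emeasure_grid_cell[OF assms(1)] by (auto simp: grid_cells_def)
  have "disjoint_family_on (\<lambda>c. c) D"
    using pairwise_subset[OF disjoint_grid_cells[OF assms(1)] D]
    by (simp add: disjoint_family_on_disjoint_image pairwise_def disjnt_def disjoint_family_on_def)
  then have "measure ?M (\<Union>c\<in>D. c) = (\<Sum>c\<in>D. measure ?M c)"
    using finite_subset[OF D finite_grid_cells] cell
    by (intro measure_finite_Union) auto
  also have "\<dots> = real (card D) * \<epsilon> ^ l"
    using assms(1) by (simp add: measure_def cell)
  finally show ?thesis by (simp add: region_volume_def)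
qed

text \<open>Each cell meets \<open>X\<close> in a singleton and cells are disjoint, so positions in
  a union of cells correspond to its cells, wherever in each cell the position was chosen.\<close>

lemma possible_positions_Union_cells:
  assumes "\<epsilon> > 0" and X: "possible_positions l \<epsilon> a m X" and D: "D \<subseteq> grid_cells l \<epsilon> a m"
  shows "finite (X \<inter> \<Union>D)" and "card (X \<inter> \<Union>D) = card D"
proof -
  have one: "\<exists>x. X \<inter> c = {x}" if "c \<in> D" for c
  proof -
    have "\<exists>!x. x \<in> X \<and> x \<in> c"
      using X D that unfolding possible_positions_def by blast
    then show ?thesis by blast
  qed
  have fin: "finite D" using finite_subset[OF D finite_grid_cells] .
  have eq: "X \<inter> \<Union>D = (\<Union>c\<in>D. X \<inter> c)" by blast
  show "finite (X \<inter> \<Union>D)"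
    unfolding eq using fin one by (metis finite_UN finite.emptyI finite_insert)
  have "card (\<Union>c\<in>D. X \<inter> c) = (\<Sum>c\<in>D. card (X \<inter> c))"
  proof (intro card_UN_disjoint fin ballI impI)
    show "finite (X \<inter> c)" if "c \<in> D" for c
      using one[OF that] by auto
    show "X \<inter> c \<inter> (X \<inter> d) = {}" if "c \<in> D" "d \<in> D" "c \<noteq> d" for c d
      using disjointD[OF disjoint_grid_cells[OF assms(1)], of c l a m d] that D by blast
  qed
  also have "\<dots> = (\<Sum>c\<in>D. 1)"
    using one by (intro sum.cong refl) fastforce
  finally show "card (X \<inter> \<Union>D) = card D"
    unfolding eq by simp
qed

text \<open>Here the geometry disappears: volumes enter the likelihood only through their ratio to
  \<open>\<epsilon> ^ l\<close>, which is a number of positions, and these numbers cancel in the sum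
  over samples.\<close>

lemma COMP_eq_multinomial_complexity:
  assumes eps: "\<epsilon> > 0" and X: "possible_positions l \<epsilon> a m X"
    and H: "histogram_model l \<epsilon> a m P" and fin: "finite P"
  shows "COMP l \<epsilon> X n P = multinomial_complexity n P"
proof -
  let ?S = "sample_box l \<epsilon> a m"
  have P: "partition_on ?S P" and XS: "X \<subseteq> ?S"
    using H X by (simp_all add: histogram_model_def possible_positions_def)
  have region: "finite (X \<inter> A) \<and> region_volume l A = real (card (X \<inter> A)) * \<epsilon> ^ l \<and>
      X \<inter> A \<noteq> {}" if A: "A \<in> P" for A
  proof -
    have "\<exists>D\<subseteq>grid_cells l \<epsilon> a m. A = \<Union>D"
      using H A by (simp add: histogram_model_def)
    then obtain D where D: "D \<subseteq> grid_cells l \<epsilon> a m" "A = \<Union>D"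
      by (elim exE conjE)
    note pos = possible_positions_Union_cells[OF eps X D(1)]
    have "A \<noteq> {}" using P A by (auto simp: partition_on_def)
    \<comment> \<open>A nonempty region contains at least one cell, hence a data position; this
      supplies the nonzero divisor for the cancellation.\<close>
    then have "card D \<noteq> 0"
      using D finite_subset[OF D(1) finite_grid_cells] by auto
    with pos(2) have "X \<inter> A \<noteq> {}" unfolding D(2) by (metis card.empty)
    moreover have "region_volume l A = real (card (X \<inter> A)) * \<epsilon> ^ l"
      unfolding D(2) region_volume_Union_cells[OF eps D(1)] pos(2) ..
    ultimately show ?thesis
      using pos(1) D(2) by blast
  qed
  have "X = (\<Union>A\<in>P. X \<inter> A)"
    using XS P by (auto simp: partition_on_def)
  then have finX: "finite X"
    using fin region by (metis finite_UN)
  have "COMP l \<epsilon> X n P = (\<Sum>y\<in>{..<n} \<rightarrow>\<^sub>E X. \<Prod>A\<in>P.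
      (real (bin_count n y A) / (real n * real (card (X \<inter> A)))) ^ bin_count n y A)"
    unfolding COMP_def
  proof (rule sum.cong[OF refl])
    fix y assume "y \<in> {..<n} \<rightarrow>\<^sub>E X"
    then have "y \<in> {..<n} \<rightarrow> ?S" using XS by (auto simp: PiE_iff)
    then show "likelihood l \<epsilon> P (ml_estimator l n y) n y = (\<Prod>A\<in>P.
        (real (bin_count n y A) / (real n * real (card (X \<inter> A)))) ^ bin_count n y A)"
      unfolding likelihood_ml_estimator[OF fin P \<open>y \<in> _ \<rightarrow> ?S\<close>]
      \<comment> \<open>The cell volume \<open>\<epsilon> ^ l\<close> in the numerator cancels
        against the same factor in \<open>region_volume l A\<close>.\<close>
      using eps by (intro prod.cong refl) (simp add: region)
  qed
  also have "\<dots> = multinomial_complexity n P"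
    using region by (intro sum_max_likelihood[OF fin finX P XS]) blast
  finally show ?thesis .
qed

theorem proposition1:
  "\<exists>C :: nat \<Rightarrow> nat \<Rightarrow> real.
     \<forall>(l::nat) (\<epsilon>::real) (a :: point) (m :: nat \<Rightarrow> nat) (X :: point set)
       (P :: point set set) (K::nat) (n::nat).
       l \<ge> 1 \<longrightarrow> \<epsilon> > 0 \<longrightarrow> possible_positions l \<epsilon> a m X \<longrightarrow>
       histogram_model l \<epsilon> a m P \<longrightarrow> card P = K \<longrightarrow> K \<ge> 1 \<longrightarrow> n \<ge> 1 \<longrightarrow>
       COMP l \<epsilon> X n P = C n K"
\<comment> \<open>The witness uses \<open>{..<K}\<close> as a standard alphabet of \<open>K\<close>
  letters, chosen before any of the geometric data.\<close>
proof (intro exI[of _ "\<lambda>n K. multinomial_complexity n {..<K}"] allI impI)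
  fix l \<epsilon> a m X P and K n :: nat
  assume "\<epsilon> > 0" "possible_positions l \<epsilon> a m X" "histogram_model l \<epsilon> a m P"
    and K: "card P = K" "K \<ge> 1"
  \<comment> \<open>An infinite set has \<open>card\<close> equal to 0, so \<open>K \<ge> 1\<close>
    yields finiteness.\<close>
  moreover have fin: "finite P" using K card_ge_0_finite[of P] by simp
  ultimately have "COMP l \<epsilon> X n P = multinomial_complexity n P"
    by (intro COMP_eq_multinomial_complexity)
  moreover obtain f where "bij_betw f P {..<K}"
    using ex_bij_betw_finite_nat[OF fin] K by (auto simp: atLeast0LessThan)
  ultimately show "COMP l \<epsilon> X n P = multinomial_complexity n {..<K}"
    using multinomial_complexity_bij by metis
qed

end
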